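(* Let $S$ be a discrete semigroup, let $T$ be a closed subsemigroup of $\beta S$, let $\mathcal{F}$ be a filter on $S$ such that $\overline{\mathcal{F}}=T$ and such that for each $V\in\mathcal{F}$ there exist $V_1,V_2\in\mathcal{F}$ satisfying $V_1V_2\subseteq V$, and let $A\subseteq S$. Then the following statements are equivalent: (a) $A$ is piecewise $\mathcal{F}$-syndetic; (b) there exists $e\in E(K(T))$ such that $\{x\in S: x^{-1}A\in e\}$ is $\mathcal{F}$-syndetic; (c) there exists $e\in E(K(T))$ such that for every $V\in\mathcal{F}$ there exists $x\in V$ for which $x^{-1}A\in e$.
   Context: $\beta S$ is the space of ultrafilters on the discrete semigroup $S$, with basic (clopen) sets $\overline{A}=\{p\in\beta S: A\in p\}$, $A\subseteq S$. For $x\in S$, $A,G\subseteq S$ put $x^{-1}A=\{y\in S: xy\in A\}$ and $G^{-1}A=\bigcup_{x\in G}x^{-1}A$. The operation on $\beta S$ is given by: $A\in p\cdot q$ iff $\{x\in S: x^{-1}A\in q\}\in p$. For a filter $\mathcal{F}$ on $S$, $\overline{\mathcal{F}}=\{p\in\beta S:\mathcal{F}\subseteq p\}$. A closed subsemigroup is nonempty. $K(T)$ is the smallest two-sided ideal of the compact right topological semigroup $T$, and $E(K(T))$ is the set of idempotents in $K(T)$. $V_1V_2=\{xy: x\in V_1,y\in V_2\}$. A set $A\subseteq S$ is $\mathcal{F}$-syndetic if for every $V\in\mathcal{F}$ there is a finite set $G\subseteq V$ such that $G^{-1}A\in\mathcal{F}$. A set $A\subseteq S$ is piecewise $\mathcal{F}$-syndetic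 if for every $V\in\mathcal{F}$ there are a finite $F_V\subseteq V$ and $W_V\in\mathcal{F}$ such that the family $\{(x^{-1}F_V^{-1}A)\cap V: V\in\mathcal{F},\ x\in W_V\}$ has the finite intersection property. *)

theory Defs
  imports "HOL-Analysis.Analysis" "HOL-Library.Set_Algebras"
begin

text \<open>The semigroup S is a type of class \<open>semigroup_mult\<close>. Filters on S are values of the library
  type \<open>'a filter\<close>; \<open>fsets F\<close> is the corresponding family of subsets of S. The library
  type also contains the improper filter \<open>bot\<close>, whose family contains the empty set.\<close>

definition fsets :: "'a filter \<Rightarrow> 'a set set" where
  "fsets F = {A. eventually (\<lambda>x. x \<in> A) F}"

typedef 'a ultrafilter =
  "{F :: 'a filter. F \<noteq> bot \<and> (\<forall>A. A \<in> fsets F \<or> - A \<in> fsets F)}"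
  morphisms filter_of Abs_ultrafilter
proof
  show "principal {undefined :: 'a} \<in>
      {F. F \<noteq> bot \<and> (\<forall>A. A \<in> fsets F \<or> - A \<in> fsets F)}"
    by (auto simp: fsets_def eventually_principal principal_eq_bot_iff)
qed

definition usets :: "'a ultrafilter \<Rightarrow> 'a set set" where
  "usets p = fsets (filter_of p)"

definition basic_clopen :: "'a set \<Rightarrow> 'a ultrafilter set" where
  "basic_clopen A = {p. A \<in> usets p}"

instantiation ultrafilter :: (type) topological_space
begin

definition open_ultrafilter :: "'a ultrafilter set \<Rightarrow> bool" where
  "open_ultrafilter = generate_topology (range basic_clopen)"

instance
  by standard (auto simp: open_ultrafilter_def intro: generate_topology.intros)

end

definition lquot :: "'a::semigroup_mult \<Rightarrow> 'a set \<Rightarrow> 'a set" where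
  "lquot x A = {y. x * y \<in> A}"

definition Lquot :: "'a::semigroup_mult set \<Rightarrow> 'a set \<Rightarrow> 'a set" where
  "Lquot G A = (\<Union>x\<in>G. lquot x A)"

text \<open>The product on \<open>\<beta>S\<close>; \<open>mem_mult_iff\<close> below is its usual description
  in terms of sets.\<close>

instantiation ultrafilter :: (semigroup_mult) semigroup_mult
begin

definition times_ultrafilter :: "'a ultrafilter \<Rightarrow> 'a ultrafilter \<Rightarrow> 'a ultrafilter" where
  "p * q = Abs_ultrafilter (Abs_filter
     (\<lambda>P. \<forall>\<^sub>F x in filter_of p. \<forall>\<^sub>F y in filter_of q. P (x * y)))"

lemma filter_of_mult:
  "eventually P (filter_of (p * q)) \<longleftrightarrow>
    (\<forall>\<^sub>F x in filter_of p. \<forall>\<^sub>F y in filter_of q. P (x * y))"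
proof -
  let ?R = "\<lambda>P. \<forall>\<^sub>F x in filter_of p. \<forall>\<^sub>F y in filter_of q. P (x * y)"
  let ?F = "Abs_filter ?R"
  have "is_filter ?R"
  proof (rule is_filter.intro)
    show "?R (\<lambda>x. P x \<and> Q x)" if "?R P" "?R Q" for P Q
      using that by (simp add: eventually_conj_iff)
    show "?R Q" if "\<forall>x. P x \<longrightarrow> Q x" "?R P" for P Q
      using that(2) by (rule eventually_mono) (use that(1) in \<open>auto elim: eventually_mono\<close>)
  qed simp
  then have ev: "eventually P ?F \<longleftrightarrow> ?R P" for P
    by (rule eventually_Abs_filter)
  have proper: "filter_of r \<noteq> bot" for r :: "'a ultrafilter"
    using filter_of[of r] by simp
  have ultra: "eventually P (filter_of r) \<or> eventually (\<lambda>x. \<not> P x) (filter_of r)"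
    for P and r :: "'a ultrafilter"
  proof -
    have "Collect P \<in> fsets (filter_of r) \<or> - Collect P \<in> fsets (filter_of r)"
      using filter_of[of r] by blast
    then show ?thesis by (simp add: fsets_def)
  qed
  have "?F \<noteq> bot"
    using proper[of p] proper[of q] by (auto simp: ev trivial_limit_def)
  moreover have "?R P \<or> ?R (\<lambda>x. \<not> P x)" for P
    using ultra[of "\<lambda>x. \<forall>\<^sub>F y in filter_of q. P (x * y)" p]
  proof
    assume "\<forall>\<^sub>F x in filter_of p. \<not> (\<forall>\<^sub>F y in filter_of q. P (x * y))"
    then have "?R (\<lambda>x. \<not> P x)"
      by (rule eventually_mono) (use ultra in blast)
    then show ?thesis ..
  qed simp
  then have "A \<in> fsets ?F \<or> - A \<in> fsets ?F" for A
    by (simp add: fsets_def ev)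
  ultimately have "filter_of (p * q) = ?F"
    unfolding times_ultrafilter_def by (intro Abs_ultrafilter_inverse) auto
  then show ?thesis
    by (simp add: ev)
qed

instance
proof
  fix p q r :: "'a ultrafilter"
  have "filter_of (p * q * r) = filter_of (p * (q * r))"
    by (rule filter_eqI) (simp add: filter_of_mult mult.assoc)
  then show "p * q * r = p * (q * r)"
    by (simp add: filter_of_inject)
qed

end

lemma mem_mult_iff: "A \<in> usets (p * q) \<longleftrightarrow> {x. lquot x A \<in> usets q} \<in> usets p"
  by (simp add: usets_def fsets_def lquot_def filter_of_mult)

definition filter_closure :: "'a filter \<Rightarrow> 'a ultrafilter set" where
  "filter_closure F = {p. fsets F \<subseteq> usets p}"

text \<open>Products of sets below are elementwise, \<open>A * B = {a * b | a b. a \<in> A \<and> b \<in> B}\<close>. For a compact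
  right topological semigroup \<open>T\<close> a least ideal exists; otherwise the value of
  \<open>smallest_ideal T\<close> may be unspecified.\<close>

definition closed_subsemigroup :: "'a::semigroup_mult ultrafilter set \<Rightarrow> bool" where
  "closed_subsemigroup T \<longleftrightarrow> T \<noteq> {} \<and> closed T \<and> T * T \<subseteq> T"

definition two_sided_ideal :: "'b::semigroup_mult set \<Rightarrow> 'b set \<Rightarrow> bool" where
  "two_sided_ideal T I \<longleftrightarrow> I \<noteq> {} \<and> I \<subseteq> T \<and> T * I \<subseteq> I \<and> I * T \<subseteq> I"

definition smallest_ideal :: "'b::semigroup_mult set \<Rightarrow> 'b set" where
  "smallest_ideal T = (LEAST I. two_sided_ideal T I)"

definition idempotents :: "'b::semigroup_mult set \<Rightarrow> 'b set" where
  "idempotents X = {e \<in> X. e * e = e}"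

definition syndetic :: "'a::semigroup_mult filter \<Rightarrow> 'a set \<Rightarrow> bool" where
  "syndetic F A \<longleftrightarrow> (\<forall>V\<in>fsets F. \<exists>G. finite G \<and> G \<subseteq> V \<and> Lquot G A \<in> fsets F)"

definition has_fip :: "'a set set \<Rightarrow> bool" where
  "has_fip \<A> \<longleftrightarrow> (\<forall>\<B>. finite \<B> \<and> \<B> \<noteq> {} \<and> \<B> \<subseteq> \<A> \<longrightarrow> \<Inter>\<B> \<noteq> {})"

text \<open>The family in the definition of piecewise syndeticity ranges over all members of the filter
  at once, so the sets \<open>F\<^sub>V\<close> and \<open>W\<^sub>V\<close> are given by functions of V.\<close>

definition piecewise_syndetic :: "'a::semigroup_mult filter \<Rightarrow> 'a set \<Rightarrow> bool" where
  "piecewise_syndetic F A \<longleftrightarrow>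
    (\<exists>G W. (\<forall>V\<in>fsets F. finite (G V) \<and> G V \<subseteq> V \<and> W V \<in> fsets F) \<and>
      has_fip {lquot x (Lquot (G V) A) \<inter> V | V x. V \<in> fsets F \<and> x \<in> W V})"

end

(*
  If A is piecewise F-syndetic, an ultrafilter r containing the given family with the finite
  intersection property satisfies T r \<subseteq> cl(G_V^{-1} A) for every V in F. The left ideal T r contains
  a minimal left ideal of T, and an idempotent e in it is as in (c). For (c) \<Longrightarrow> (b): if q lies in the
  minimal left ideal T e, then e lies in T q, so x^{-1} A \<in> e with x in V_1 yields some y in V_2 with
  (x y)^{-1} A \<in> q, and x y \<in> V. Thus every p e with p in T contains some g^{-1} A with g in V, and
  compactness of T leaves finitely many g. Finally (b) \<Longrightarrow> (a) because e itself contains the required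
  family.
*)
theory Submission
  imports Defs
begin

section \<open>Minimal left ideals and idempotents\<close>

text \<open>Zorn's lemma applied to complements, so that maximal complements give minimal sets.
  Compactness of \<open>X\<close> keeps the intersection of a chain nonempty, and
  \<open>Inter\<close> then returns it to \<open>P\<close>. It serves both closed subsemigroups and
  closed left ideals.\<close>

lemma minimal_closed_set:
  fixes X :: "'b::t2_space set"
  assumes "compact X" "P X"
    and P: "\<And>Y. P Y \<Longrightarrow> closed Y \<and> Y \<noteq> {}"
    and Inter: "\<And>\<C>. \<C> \<noteq> {} \<Longrightarrow> (\<And>Y. Y \<in> \<C> \<Longrightarrow> P Y) \<Longrightarrow> \<Inter>\<C> \<noteq> {} \<Longrightarrow> P (\<Inter>\<C>)"
  obtains M where "P M" "M \<subseteq> X" "\<And>Y. P Y \<Longrightarrow> Y \<subseteq> M \<Longrightarrow> Y = M"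
proof -
  let ?A = "uminus ` {Y. P Y \<and> Y \<subseteq> X}"
  have "\<exists>M\<in>?A. \<forall>Y\<in>?A. M \<subseteq> Y \<longrightarrow> Y = M"
  proof (rule subset_Zorn_nonempty)
    show "?A \<noteq> {}" using assms(2) by auto
    fix \<C> assume "\<C> \<noteq> {}" and chain: "subset.chain ?A \<C>"
    define \<D> where "\<D> = uminus ` \<C>"
    have \<D>: "\<D> \<noteq> {}" "\<And>Y. Y \<in> \<D> \<Longrightarrow> P Y \<and> Y \<subseteq> X"
      using \<open>\<C> \<noteq> {}\<close> chain by (auto simp: \<D>_def subset_chain_def)
    have chain': "subset.chain {Y. P Y \<and> Y \<subseteq> X} \<D>"
      using chain unfolding \<D>_def subset_chain_def by auto
    have "X \<inter> \<Inter>\<D> \<noteq> {}"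
    proof (rule compact_imp_fip[OF \<open>compact X\<close>])
      show "closed Y" if "Y \<in> \<D>" for Y using \<D>(2) P that by blast
      show "X \<inter> \<Inter>\<E> \<noteq> {}" if "finite \<E>" "\<E> \<subseteq> \<D>" for \<E>
      proof (cases "\<E> = {}")
        case True
        then show ?thesis using P assms(2) by simp
      next
        case False
        have "subset.chain {Y. P Y \<and> Y \<subseteq> X} \<E>"
          using chain' that(2) unfolding subset_chain_def by (meson order_trans subsetD)
        then have "\<Inter>\<E> \<in> \<E>"
          by (rule Inter_in_chain[OF that(1) False])
        then have "P (\<Inter>\<E>)" "\<Inter>\<E> \<subseteq> X" using \<D>(2) that(2) by blast+
        then show ?thesis using P by (metis inf.absorb2)
      qed
    qed
    then have "P (\<Inter>\<D>)" "\<Inter>\<D> \<subseteq> X"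
      using Inter[of \<D>] \<D> by auto
    moreover have "\<Union>\<C> = - \<Inter>\<D>" by (auto simp: \<D>_def)
    ultimately show "\<Union>\<C> \<in> ?A" by blast
  qed
  then obtain M where M: "P M" "M \<subseteq> X" and max: "\<forall>Y\<in>?A. - M \<subseteq> Y \<longrightarrow> Y = - M"
    by auto
  have "Y = M" if "P Y" "Y \<subseteq> M" for Y
    using max[rule_format, of "- Y"] M that by auto
  with M show thesis by (rule that)
qed

section \<open>Compact right topological semigroups and their left ideals\<close>

definition left_ideal :: "'b::semigroup_mult set \<Rightarrow> 'b set \<Rightarrow> bool" where
  "left_ideal T L \<longleftrightarrow> L \<noteq> {} \<and> L \<subseteq> T \<and> T * L \<subseteq> L"

definition minimal_left_ideal :: "'b::semigroup_mult set \<Rightarrow> 'b set \<Rightarrow> bool" where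
  "minimal_left_ideal T L \<longleftrightarrow> left_ideal T L \<and> (\<forall>J. left_ideal T J \<longrightarrow> J \<subseteq> L \<longrightarrow> J = L)"

text \<open>The semigroup is a subset \<open>T\<close> and not a whole type, so that a minimal left
  ideal of \<open>T\<close> can later take its place.\<close>

locale compact_right_topological_semigroup =
  fixes T :: "'b::{semigroup_mult, t2_space} set"
  assumes compact: "compact T"
    and nonempty: "T \<noteq> {}"
    and mult_subset: "T * T \<subseteq> T"
    and continuous_mult: "q \<in> T \<Longrightarrow> continuous_on T (\<lambda>p. p * q)"
begin

lemma mult_closed: "p \<in> T \<Longrightarrow> q \<in> T \<Longrightarrow> p * q \<in> T"
  using mult_subset by (auto intro: set_times_intro)

text \<open>The Ellis-Numakura argument: in a minimal closed subsemigroup \<open>M\<close>, every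
  element turns out to be idempotent.\<close>

lemma idempotent_exists: "\<exists>e\<in>T. e * e = e"
proof -
  let ?P = "\<lambda>Y. closed Y \<and> Y \<noteq> {} \<and> Y \<subseteq> T \<and> (\<forall>x\<in>Y. \<forall>y\<in>Y. x * y \<in> Y)"
  obtain M where M: "?P M" and min: "\<And>Y. ?P Y \<Longrightarrow> Y \<subseteq> M \<Longrightarrow> Y = M"
  proof (rule minimal_closed_set[of T ?P])
    show "?P T" using compact nonempty mult_closed by (auto intro: compact_imp_closed)
    show "?P (\<Inter>\<C>)" if "\<C> \<noteq> {}" "\<And>Y. Y \<in> \<C> \<Longrightarrow> ?P Y" "\<Inter>\<C> \<noteq> {}" for \<C>
      using that by (auto intro!: closed_Inter) blast
  qed (use compact in auto)
  obtain e where e: "e \<in> M" using M by blast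
  have cont: "continuous_on M (\<lambda>p. p * e)"
    using continuous_mult[of e] M e by (auto intro: continuous_on_subset)
  have "compact M" using compact M by (metis closed_Int_compact inf.absorb1)
  then have "closed ((\<lambda>p. p * e) ` M)"
    using cont by (intro compact_imp_closed compact_continuous_image)
  \<comment> \<open>\<open>M e\<close> is a closed subsemigroup of \<open>M\<close>, so minimality
    applies and \<open>e\<close> itself has the form \<open>s e\<close>.\<close>
  then have "(\<lambda>p. p * e) ` M = M"
    using M e by (intro min) (auto simp: mult_closed subset_eq mult.assoc[symmetric])
  then obtain s where s: "s \<in> M" "s * e = e" using e by (metis imageE)
  \<comment> \<open>The solutions of \<open>p * e = e\<close> form a closed subsemigroup, nonempty
    because of \<open>s\<close>. By minimality \<open>e\<close> is among them.\<close>
  have "closed {p \<in> M. p * e = e}"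
    using continuous_closed_preimage[OF cont, of "{e}"] M by (simp add: vimage_def Int_def)
  then have "{p \<in> M. p * e = e} = M"
    using M s by (intro min) (auto simp: mult.assoc)
  then show ?thesis using e M by blast
qed

lemma left_ideal_orbit: "q \<in> T \<Longrightarrow> left_ideal T ((\<lambda>p. p * q) ` T)"
  using nonempty by (auto simp: left_ideal_def mult_closed mult.assoc[symmetric] elim!: set_times_elim)

text \<open>\<open>T q\<close> is a left ideal inside \<open>L\<close>, so minimality forces
  equality. Hence any element of \<open>L\<close> is a left multiple of any other.\<close>

lemma minimal_left_ideal_orbit:
  assumes "minimal_left_ideal T L" "q \<in> L"
  shows "(\<lambda>p. p * q) ` T = L"
proof -
  have "q \<in> T" "(\<lambda>p. p * q) ` T \<subseteq> L"
    using assms by (auto simp: minimal_left_ideal_def left_ideal_def intro: set_times_intro)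
  then show ?thesis using assms left_ideal_orbit by (auto simp: minimal_left_ideal_def)
qed

lemma closed_orbit: "q \<in> T \<Longrightarrow> closed ((\<lambda>p. p * q) ` T)"
  by (intro compact_imp_closed compact_continuous_image continuous_mult compact)

text \<open>\<open>J\<close> need not be closed, so the search for a minimal closed left ideal takes
  place in a compact orbit \<open>T q\<close> inside \<open>J\<close>.\<close>

lemma minimal_left_ideal_exists:
  assumes "left_ideal T J"
  obtains L where "minimal_left_ideal T L" "L \<subseteq> J"
proof -
  obtain q where q: "q \<in> J" "q \<in> T" using assms by (auto simp: left_ideal_def)
  let ?X = "(\<lambda>p. p * q) ` T" and ?P = "\<lambda>Y. closed Y \<and> left_ideal T Y"
  obtain M where M: "?P M" "M \<subseteq> ?X" and min: "\<And>Y. ?P Y \<Longrightarrow> Y \<subseteq> M \<Longrightarrow> Y = M"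
  proof (rule minimal_closed_set[of ?X ?P])
    show "compact ?X" by (intro compact_continuous_image continuous_mult compact q)
    show "?P ?X" using closed_orbit left_ideal_orbit q by blast
    show "?P (\<Inter>\<C>)" if "\<C> \<noteq> {}" "\<And>Y. Y \<in> \<C> \<Longrightarrow> ?P Y" "\<Inter>\<C> \<noteq> {}" for \<C>
    proof -
      have "\<Inter>\<C> \<subseteq> T" "T * \<Inter>\<C> \<subseteq> \<Inter>\<C>"
        using that unfolding left_ideal_def
        by (blast, meson Inf_lower le_Inf_iff order_refl order_trans set_times_mono2)
      then show ?thesis using that by (auto simp: left_ideal_def intro!: closed_Inter)
    qed
  qed (auto simp: left_ideal_def)
  have "minimal_left_ideal T M"
    unfolding minimal_left_ideal_def
  proof (intro conjI allI impI)
    \<comment> \<open>Minimality among closed left ideals suffices: any left ideal \<open>I\<close>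
      contains the closed left ideal \<open>T r\<close> for each \<open>r\<close> in
      \<open>I\<close>.\<close>
    fix I assume I: "left_ideal T I" "I \<subseteq> M"
    then obtain r where r: "r \<in> I" "r \<in> T" by (auto simp: left_ideal_def)
    then have "(\<lambda>p. p * r) ` T \<subseteq> I" using I by (auto simp: left_ideal_def intro: set_times_intro)
    moreover from this have "(\<lambda>p. p * r) ` T = M"
      using closed_orbit left_ideal_orbit r I by (intro min) auto
    ultimately show "I = M" using I by blast
  qed (use M in simp)
  moreover have "M \<subseteq> J"
    using M q assms by (fastforce simp: left_ideal_def intro: set_times_intro)
  ultimately show thesis by (rule that)
qed

text \<open>A left ideal \<open>J\<close> inside \<open>L t\<close> pulls back to the left ideal of
  all \<open>x\<close> in \<open>L\<close> with \<open>x * t\<close> in \<open>J\<close>, which is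
  all of \<open>L\<close>. This makes the union of the minimal left ideals a right ideal
  too.\<close>

lemma minimal_left_ideal_translate:
  assumes L: "minimal_left_ideal T L" and t: "t \<in> T"
  shows "minimal_left_ideal T ((\<lambda>x. x * t) ` L)"
  unfolding minimal_left_ideal_def
proof (intro conjI allI impI)
  have L': "L \<noteq> {}" "L \<subseteq> T" "\<And>p x. p \<in> T \<Longrightarrow> x \<in> L \<Longrightarrow> p * x \<in> L"
    using L by (auto simp: minimal_left_ideal_def left_ideal_def intro: set_times_intro)
  then show "left_ideal T ((\<lambda>x. x * t) ` L)"
    using t by (auto simp: left_ideal_def mult_closed subset_eq mult.assoc[symmetric] elim!: set_times_elim)
  fix J assume J: "left_ideal T J" "J \<subseteq> (\<lambda>x. x * t) ` L"
  have J': "p * x \<in> J" if "p \<in> T" "x \<in> J" for p x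
    using J that by (auto simp: left_ideal_def intro: set_times_intro)
  have "left_ideal T {x \<in> L. x * t \<in> J}"
    using J L' by (auto simp: left_ideal_def mult.assoc intro: J' elim!: set_times_elim)
  then have "{x \<in> L. x * t \<in> J} = L"
    using L by (auto simp: minimal_left_ideal_def)
  then show "J = (\<lambda>x. x * t) ` L" using J by blast
qed

lemma smallest_ideal_eq: "smallest_ideal T = \<Union>{L. minimal_left_ideal T L}"
  unfolding smallest_ideal_def
proof (rule Least_equality)
  let ?K = "\<Union>{L. minimal_left_ideal T L}"
  have min_subset: "L \<subseteq> T" "T * L \<subseteq> L" "L \<noteq> {}" if "minimal_left_ideal T L" for L
    using that by (auto simp: minimal_left_ideal_def left_ideal_def)
  have "left_ideal T T" using nonempty mult_subset by (simp add: left_ideal_def)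
  then obtain L where "minimal_left_ideal T L" by (rule minimal_left_ideal_exists)
  then have "?K \<noteq> {}" using min_subset(3) by blast
  moreover have "?K \<subseteq> T" using min_subset(1) by blast
  moreover have "T * ?K \<subseteq> ?K"
    using min_subset(2) by (blast elim: set_times_elim intro: set_times_intro)
  moreover have "?K * T \<subseteq> ?K"
    by (blast elim: set_times_elim intro: minimal_left_ideal_translate)
  ultimately show "two_sided_ideal T ?K" by (simp add: two_sided_ideal_def)
  fix I assume I: "two_sided_ideal T I"
  show "?K \<subseteq> I"
  proof (intro Union_least, clarify)
    fix L x assume L: "minimal_left_ideal T L" and x: "x \<in> L"
    obtain i where i: "i \<in> I" "i \<in> T" using I by (auto simp: two_sided_ideal_def)
    have "i * x \<in> L" using L x i min_subset(2) by (meson set_times_intro subsetD)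
    \<comment> \<open>Multiplying \<open>x\<close> by \<open>i\<close> moves it into
      \<open>I\<close>; minimality of \<open>L\<close> allows a return to \<open>x\<close> by a left
      multiplication, which stays in \<open>I\<close>.\<close>
    then obtain t where "t \<in> T" "x = t * (i * x)"
      using minimal_left_ideal_orbit[OF L, of "i * x"] x by blast
    moreover have "x \<in> T" using L x min_subset by blast
    then have "i * x \<in> I" using I i by (auto simp: two_sided_ideal_def intro: set_times_intro)
    ultimately show "x \<in> I" using I by (metis subsetD set_times_intro two_sided_ideal_def)
  qed
qed

lemma idempotent_smallest_ideal_exists:
  assumes "left_ideal T J"
  obtains e where "e \<in> idempotents (smallest_ideal T)" "e \<in> J"
proof -
  obtain L where L: "minimal_left_ideal T L" "L \<subseteq> J"
    using minimal_left_ideal_exists[OF assms] .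
  then have L': "L \<noteq> {}" "L \<subseteq> T" "T * L \<subseteq> L"
    by (auto simp: minimal_left_ideal_def left_ideal_def)
  then obtain q where q: "q \<in> L" "q \<in> T" by blast
  \<comment> \<open>As an orbit \<open>T q\<close>, \<open>L\<close> is a continuous image of
    \<open>T\<close> and hence compact, so it has an idempotent of its own.\<close>
  interpret L: compact_right_topological_semigroup L
  proof
    show "compact L"
      using minimal_left_ideal_orbit[OF L(1) q(1)] q
        compact_continuous_image[OF continuous_mult compact] by metis
    show "L * L \<subseteq> L" using L' by (meson order_refl order_trans set_times_mono2)
    show "continuous_on L (\<lambda>p. p * x)" if "x \<in> L" for x
      using continuous_mult[of x] L' that by (auto intro: continuous_on_subset)
  qed (use L' in simp)
  obtain e where "e \<in> L" "e * e = e" using L.idempotent_exists by blast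
  with L show thesis by (intro that[of e]) (auto simp: idempotents_def smallest_ideal_eq)
qed

end

section \<open>The space of ultrafilters\<close>

lemma eventually_iff_usets: "eventually P (filter_of p) \<longleftrightarrow> Collect P \<in> usets p"
  by (simp add: usets_def fsets_def)

lemma usets_Compl: "- A \<in> usets p \<longleftrightarrow> A \<notin> usets p"
proof -
  have p: "filter_of p \<noteq> bot" "A \<in> usets p \<or> - A \<in> usets p"
    using filter_of[of p] by (auto simp: usets_def)
  moreover have "\<not> (A \<in> usets p \<and> - A \<in> usets p)"
  proof
    assume "A \<in> usets p \<and> - A \<in> usets p"
    then have "eventually (\<lambda>x. x \<in> A) (filter_of p)" "eventually (\<lambda>x. x \<notin> A) (filter_of p)"
      by (simp_all add: usets_def fsets_def)
    then have "eventually (\<lambda>x. False) (filter_of p)" by eventually_elim simp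
    then show False using p by (simp add: trivial_limit_def)
  qed
  ultimately show ?thesis by blast
qed

lemma usets_Int: "A \<inter> B \<in> usets p \<longleftrightarrow> A \<in> usets p \<and> B \<in> usets p"
  by (simp add: usets_def fsets_def eventually_conj_iff)

lemma usets_mono: "A \<in> usets p \<Longrightarrow> A \<subseteq> B \<Longrightarrow> B \<in> usets p"
  by (auto simp: usets_def fsets_def elim: eventually_mono)

lemma empty_notin_usets [simp]: "{} \<notin> usets p"
  using filter_of[of p] by (simp add: usets_def fsets_def trivial_limit_def)

lemma usets_finite_UN: "finite G \<Longrightarrow> (\<Union>x\<in>G. B x) \<in> usets p \<longleftrightarrow> (\<exists>x\<in>G. B x \<in> usets p)"
proof (induction G rule: finite_induct)
  case (insert x G)
  have "A \<union> B \<in> usets p \<longleftrightarrow> A \<in> usets p \<or> B \<in> usets p" for A B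
    by (metis Compl_Un usets_Compl usets_Int)
  with insert show ?case by simp
qed (simp add: empty_notin_usets)

lemma usets_finite_INT: "finite G \<Longrightarrow> G \<noteq> {} \<Longrightarrow> \<Inter>G \<in> usets p \<longleftrightarrow> (\<forall>B\<in>G. B \<in> usets p)"
  by (induction G rule: finite_ne_induct) (auto simp: usets_Int)

lemma usets_inject: "usets p = usets q \<longleftrightarrow> p = q"
proof
  assume "usets p = usets q"
  then have "filter_of p = filter_of q"
    by (intro filter_eqI) (simp add: eventually_iff_usets)
  then show "p = q" by (simp add: filter_of_inject)
qed simp

text \<open>The order on filters is reverse inclusion of their families: the finer filter is the
  smaller one.\<close>

lemma fsets_subset_usets_iff: "fsets F \<subseteq> usets p \<longleftrightarrow> filter_of p \<le> F"
proof
  assume "fsets F \<subseteq> usets p"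
  then show "filter_of p \<le> F"
    by (intro filter_leI) (auto simp: eventually_iff_usets fsets_def)
next
  assume "filter_of p \<le> F"
  then show "fsets F \<subseteq> usets p"
    by (auto simp: usets_def fsets_def le_filter_def)
qed

text \<open>The ultrafilter lemma. In the reversed order an ultrafilter is a minimal proper filter,
  found by Zorn's lemma below \<open>F\<close>.\<close>

lemma ultrafilter_below:
  fixes F :: "'a filter"
  assumes "F \<noteq> bot"
  obtains p where "filter_of p \<le> F"
proof -
  let ?A = "{G. G \<noteq> bot \<and> G \<le> F}"
  have "\<exists>m\<in>?A. \<forall>a\<in>?A. a \<le> m \<longrightarrow> a = m"
  proof (rule predicate_Zorn)
    show "partial_order_on ?A (relation_of (\<lambda>x y. y \<le> x) ?A)"
      by (rule partial_order_on_relation_ofI) auto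
    fix C assume C: "C \<in> Chains (relation_of (\<lambda>x y. y \<le> x) ?A)"
    then have CA: "C \<subseteq> ?A" by (rule Chains_relation_of)
    show "\<exists>u\<in>?A. \<forall>a\<in>C. u \<le> a"
    proof (cases "C = {}")
      case True
      then show ?thesis using assms by auto
    next
      case False
      \<comment> \<open>A chain is directed downwards, so the family of \<open>Inf C\<close> is the
        union of the families in \<open>C\<close> and omits the empty set.\<close>
      have "\<exists>x\<in>C. x \<le> inf G H" if "G \<in> C" "H \<in> C" for G H
        using C that by (auto simp: Chains_def relation_of_def)
      then have "eventually P (Inf C) \<longleftrightarrow> (\<exists>b\<in>C. eventually P b)" for P
        by (rule eventually_Inf_base[OF False])
      then have "Inf C \<noteq> bot" using CA by (auto simp: trivial_limit_def)
      moreover have "Inf C \<le> F" using False CA by (auto intro: Inf_lower2)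
      ultimately show ?thesis by (auto intro: Inf_lower)
    qed
  qed
  then obtain M where M: "M \<noteq> bot" "M \<le> F" and min: "\<And>G. G \<noteq> bot \<Longrightarrow> G \<le> M \<Longrightarrow> G = M"
    by force
  \<comment> \<open>Adjoining \<open>B\<close> to \<open>M\<close> either gives the improper filter,
    and then \<open>- B\<close> belongs to \<open>M\<close>, or changes nothing by
    minimality.\<close>
  have "B \<in> fsets M \<or> - B \<in> fsets M" for B
  proof (cases "inf M (principal B) = bot")
    case True
    then have "eventually (\<lambda>x. x \<in> B \<longrightarrow> False) M"
      by (simp add: trivial_limit_def eventually_inf_principal)
    then show ?thesis by (simp add: fsets_def)
  next
    case False
    then have "inf M (principal B) = M" by (intro min) auto
    then have "M \<le> principal B" by (simp add: inf.absorb_iff1)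
    then show ?thesis by (simp add: fsets_def le_principal)
  qed
  with M have "filter_of (Abs_ultrafilter M) = M"
    by (intro Abs_ultrafilter_inverse) auto
  with M show thesis by (intro that[of "Abs_ultrafilter M"]) simp
qed

text \<open>A filter is the intersection of the ultrafilters extending it: if \<open>B\<close> is
  missing from \<open>F\<close>, then \<open>- B\<close> can be adjoined and the result refined to
  an ultrafilter.\<close>

lemma fsets_iff_filter_closure: "B \<in> fsets F \<longleftrightarrow> (\<forall>p\<in>filter_closure F. B \<in> usets p)"
proof
  assume *: "\<forall>p\<in>filter_closure F. B \<in> usets p"
  show "B \<in> fsets F"
  proof (rule ccontr)
    assume "B \<notin> fsets F"
    then have "inf F (principal (- B)) \<noteq> bot"
      by (simp add: trivial_limit_def eventually_inf_principal fsets_def)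
    then obtain p where "filter_of p \<le> inf F (principal (- B))"
      by (rule ultrafilter_below)
    then have "filter_of p \<le> F" "filter_of p \<le> principal (- B)" by simp_all
    then have "p \<in> filter_closure F" "- B \<in> usets p"
      by (simp_all add: filter_closure_def fsets_subset_usets_iff) (simp add: le_principal usets_def fsets_def)
    with * show False by (simp add: usets_Compl)
  qed
qed (auto simp: filter_closure_def)

text \<open>The finite intersection property says that finite infima of the principal filters are
  proper. Then the full infimum is proper and lies above an ultrafilter.\<close>

lemma has_fip_iff_usets:
  assumes "\<A> \<noteq> {}"
  shows "has_fip \<A> \<longleftrightarrow> (\<exists>p. \<A> \<subseteq> usets p)"
proof
  assume fip: "has_fip \<A>"
  have "Inf (principal ` \<A>) \<noteq> bot"
  proof (rule Inf_filter_not_bot)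
    fix X assume "X \<subseteq> principal ` \<A>" "finite X"
    then obtain \<B> where \<B>: "finite \<B>" "\<B> \<subseteq> \<A>" "X = principal ` \<B>"
      by (meson finite_subset_image)
    have "\<Inter>\<B> \<noteq> {}" using \<B> fip by (cases "\<B> = {}") (auto simp: has_fip_def)
    then show "Inf X \<noteq> bot"
      using INF_principal_finite[OF \<B>(1), of id] \<B>(3) by (simp add: principal_eq_bot_iff)
  qed
  then obtain p where "filter_of p \<le> Inf (principal ` \<A>)" by (rule ultrafilter_below)
  then have "\<A> \<subseteq> usets p"
    by (auto simp: le_Inf_iff le_principal usets_def fsets_def)
  then show "\<exists>p. \<A> \<subseteq> usets p" ..
next
  assume "\<exists>p. \<A> \<subseteq> usets p"
  then obtain p where p: "\<A> \<subseteq> usets p" ..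
  show "has_fip \<A>"
    unfolding has_fip_def
  proof (intro allI impI)
    fix \<B> assume "finite \<B> \<and> \<B> \<noteq> {} \<and> \<B> \<subseteq> \<A>"
    then have "\<Inter>\<B> \<in> usets p" using p by (auto simp: usets_finite_INT)
    then show "\<Inter>\<B> \<noteq> {}" using empty_notin_usets by metis
  qed
qed

section \<open>The topology of \<beta>S\<close>

lemma open_basic_clopen: "open (basic_clopen A)"
  by (simp add: open_ultrafilter_def generate_topology.Basis)

text \<open>The generating sets are stable under binary intersection, so they form a base and not
  only a subbase.\<close>

lemma basic_clopen_base:
  assumes "open U" "p \<in> U"
  obtains A where "p \<in> basic_clopen A" "basic_clopen A \<subseteq> U"
proof -
  have "generate_topology (range basic_clopen) U" using assms by (simp add: open_ultrafilter_def)
  then have "\<exists>A. p \<in> basic_clopen A \<and> basic_clopen A \<subseteq> U" using assms(2)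
  proof induction
    case UNIV
    then show ?case by (auto simp: basic_clopen_def usets_def fsets_def intro: exI[of _ UNIV])
  next
    case (Int U V)
    then obtain A B where "p \<in> basic_clopen A" "basic_clopen A \<subseteq> U"
      "p \<in> basic_clopen B" "basic_clopen B \<subseteq> V" by blast
    then show ?case by (intro exI[of _ "A \<inter> B"]) (auto simp: basic_clopen_def usets_Int)
  next
    case (UN \<U>)
    then show ?case by blast
  qed blast
  then show thesis using that by blast
qed

text \<open>Distinct ultrafilters disagree on some \<open>A\<close>; the basic sets of
  \<open>A\<close> and \<open>- A\<close> separate them.\<close>

instance ultrafilter :: (type) t2_space
proof
  fix p q :: "'a ultrafilter"
  assume "p \<noteq> q"
  then have "\<exists>A. A \<in> usets p \<and> - A \<in> usets q"
    using usets_inject[of p q] usets_Compl by blast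
  then obtain A where A: "A \<in> usets p" "- A \<in> usets q" by blast
  show "\<exists>U V. open U \<and> open V \<and> p \<in> U \<and> q \<in> V \<and> U \<inter> V = {}"
  proof (intro exI conjI)
    show "open (basic_clopen A)" "open (basic_clopen (- A))"
      by (rule open_basic_clopen)+
  qed (use A in \<open>auto simp: basic_clopen_def usets_Compl\<close>)
qed

lemma compact_UNIV_ultrafilter: "compact (UNIV :: 'a ultrafilter set)"
  unfolding compact_filter
proof (intro allI impI)
  fix \<Phi> :: "'a ultrafilter filter"
  assume \<Phi>: "\<Phi> \<noteq> bot"
  \<comment> \<open>\<open>F\<close> consists of the sets whose basic clopen set belongs to
    \<open>\<Phi>\<close>. Any ultrafilter refining \<open>F\<close> is a cluster point of
    \<open>\<Phi>\<close>.\<close>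
  define F where "F = Abs_filter (\<lambda>P. \<forall>\<^sub>F p in \<Phi>. eventually P (filter_of p))"
  have ev: "eventually P F \<longleftrightarrow> (\<forall>\<^sub>F p in \<Phi>. eventually P (filter_of p))" for P
    unfolding F_def
    by (rule eventually_Abs_filter, rule is_filter.intro)
      (auto simp: eventually_conj_iff elim!: eventually_mono)
  have "F \<noteq> bot"
    using \<Phi> by (auto simp: trivial_limit_def ev eventually_iff_usets)
  then obtain p where p: "filter_of p \<le> F" by (rule ultrafilter_below)
  have "inf (nhds p) \<Phi> \<noteq> bot"
  proof
    assume "inf (nhds p) \<Phi> = bot"
    then obtain Q R where Q: "eventually Q (nhds p)" and R: "eventually R \<Phi>"
      and QR: "\<And>x. Q x \<Longrightarrow> R x \<Longrightarrow> False"
      by (auto simp: trivial_limit_def eventually_inf)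
    obtain A where A: "p \<in> basic_clopen A" "\<And>q. q \<in> basic_clopen A \<Longrightarrow> Q q"
      using Q basic_clopen_base unfolding eventually_nhds by (metis subsetD)
    have "\<forall>\<^sub>F q in \<Phi>. - A \<in> usets q"
      using R by (rule eventually_mono) (use A QR in \<open>auto simp: basic_clopen_def usets_Compl\<close>)
    then have "eventually (\<lambda>x. x \<in> - A) F" by (simp add: ev usets_def fsets_def)
    with p have "- A \<in> usets p" by (auto simp: le_filter_def usets_def fsets_def)
    with A show False by (simp add: basic_clopen_def usets_Compl)
  qed
  then show "\<exists>x\<in>UNIV. inf (nhds x) \<Phi> \<noteq> bot" by blast
qed

text \<open>The preimage of a basic clopen set under right translation by \<open>q\<close> is again
  basic clopen, directly from the description of the product.\<close>

lemma continuous_on_mult_ultrafilter: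
  fixes q :: "'a::semigroup_mult ultrafilter"
  shows "continuous_on T (\<lambda>p. p * q)"
proof -
  have "open ((\<lambda>p. p * q) -` U)" if "open U" for U
    using that[unfolded open_ultrafilter_def]
  proof induction
    case (Basis U)
    then obtain A where "U = basic_clopen A" by blast
    then have "(\<lambda>p. p * q) -` U = basic_clopen {x. lquot x A \<in> usets q}"
      by (auto simp: basic_clopen_def mem_mult_iff)
    then show ?case by (simp add: open_basic_clopen)
  qed (auto simp: vimage_Union)
  then have "continuous_on UNIV (\<lambda>p. p * q)"
    by (simp add: continuous_on_open_vimage)
  then show ?thesis by (rule continuous_on_subset) simp
qed

lemma closed_subsemigroup_imp_compact:
  assumes "closed_subsemigroup T"
  shows "compact_right_topological_semigroup T"
  using assms compact_UNIV_ultrafilter closed_Int_compact[of T UNIV]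
  by unfold_locales (auto simp: closed_subsemigroup_def continuous_on_mult_ultrafilter)

section \<open>Piecewise syndetic sets\<close>

lemma lquot_lquot: "lquot y (lquot x A) = lquot (x * y) A"
  by (simp add: lquot_def mult.assoc)

lemma Lquot_mult_mem_iff:
  assumes "finite G"
  shows "lquot x (Lquot G A) \<in> usets p \<longleftrightarrow> (\<exists>g\<in>G. lquot (g * x) A \<in> usets p)"
proof -
  have "lquot x (Lquot G A) = (\<Union>g\<in>G. lquot (g * x) A)"
    by (auto simp: lquot_def Lquot_def mult.assoc)
  then show ?thesis by (simp add: usets_finite_UN assms)
qed

lemma Lquot_mem_iff:
  assumes "finite G"
  shows "Lquot G A \<in> usets p \<longleftrightarrow> (\<exists>g\<in>G. lquot g A \<in> usets p)"
  by (simp add: Lquot_def usets_finite_UN assms)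

theorem theorem2p9:
  fixes T :: "'a::semigroup_mult ultrafilter set"
    and F :: "'a filter"
    and A :: "'a set"
  assumes "closed_subsemigroup T"
    and "filter_closure F = T"
    and "\<forall>V\<in>fsets F. \<exists>V1\<in>fsets F. \<exists>V2\<in>fsets F. V1 * V2 \<subseteq> V"
  shows "(piecewise_syndetic F A \<longleftrightarrow>
           (\<exists>e\<in>idempotents (smallest_ideal T). syndetic F {x. lquot x A \<in> usets e})) \<and>
         ((\<exists>e\<in>idempotents (smallest_ideal T). syndetic F {x. lquot x A \<in> usets e}) \<longleftrightarrow>
           (\<exists>e\<in>idempotents (smallest_ideal T). \<forall>V\<in>fsets F. \<exists>x\<in>V. lquot x A \<in> usets e))"
    (is "(?a \<longleftrightarrow> ?b) \<and> (?b \<longleftrightarrow> ?c)")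
proof -
  interpret T: compact_right_topological_semigroup T
    using assms(1) by (rule closed_subsemigroup_imp_compact)
  \<comment> \<open>Membership in \<open>F\<close> can be tested on the points of \<open>T\<close>;
    this translates between the filter and the semigroup.\<close>
  have mem_F: "B \<in> fsets F \<longleftrightarrow> (\<forall>p\<in>T. B \<in> usets p)" for B
    using fsets_iff_filter_closure[of B F] assms(2) by simp
  have mem_T: "p \<in> T \<longleftrightarrow> fsets F \<subseteq> usets p" for p
    using assms(2) by (auto simp: filter_closure_def)
  have fsets_ne: "B \<noteq> {}" if "B \<in> fsets F" for B
    using that T.nonempty mem_F empty_notin_usets by blast
  have UNIV_F: "UNIV \<in> fsets F" by (simp add: fsets_def)

  have family_ne: "{lquot x (Lquot (G V) A) \<inter> V | V x. V \<in> fsets F \<and> x \<in> W V} \<noteq> {}"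
    if "\<And>V. V \<in> fsets F \<Longrightarrow> W V \<in> fsets F" for G W
    using fsets_ne[OF that[OF UNIV_F]] UNIV_F by blast

  \<comment> \<open>From piecewise syndetic sets to an idempotent: (a) implies (c)\<close>
  have "?c" if a: ?a
  proof -
    obtain G W where GW: "\<forall>V\<in>fsets F. finite (G V) \<and> G V \<subseteq> V \<and> W V \<in> fsets F"
      and fip: "has_fip {lquot x (Lquot (G V) A) \<inter> V | V x. V \<in> fsets F \<and> x \<in> W V}"
      using a unfolding piecewise_syndetic_def by (elim exE conjE)
    note GW = GW[rule_format]
    have "{lquot x (Lquot (G V) A) \<inter> V | V x. V \<in> fsets F \<and> x \<in> W V} \<noteq> {}"
      by (rule family_ne) (simp add: GW)
    from iffD1[OF has_fip_iff_usets[OF this] fip]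
    obtain r where r: "{lquot x (Lquot (G V) A) \<inter> V | V x. V \<in> fsets F \<and> x \<in> W V} \<subseteq> usets r" ..
    have quot_r: "lquot x (Lquot (G V) A) \<in> usets r \<and> V \<in> usets r"
      if "V \<in> fsets F" "x \<in> W V" for V x
    proof -
      have "lquot x (Lquot (G V) A) \<inter> V \<in> usets r"
        using that by (intro subsetD[OF r]) blast
      then show ?thesis by (simp add: usets_Int)
    qed
    \<comment> \<open>The intersection with \<open>V\<close> in the family places \<open>r\<close>
      in \<open>T\<close>; some \<open>x\<close> in \<open>W V\<close> is available because
      \<open>F\<close> is proper.\<close>
    have "V \<in> usets r" if "V \<in> fsets F" for V
      using quot_r[OF that] fsets_ne[of "W V"] GW[OF that] by blast
    then have "r \<in> T" by (auto simp: mem_T)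
    then obtain e where e: "e \<in> idempotents (smallest_ideal T)" "e \<in> (\<lambda>p. p * r) ` T"
      using T.idempotent_smallest_ideal_exists[OF T.left_ideal_orbit] by metis
    then obtain p where p: "p \<in> T" "e = p * r" by blast
    have "\<exists>x\<in>V. lquot x A \<in> usets e" if V: "V \<in> fsets F" for V
    proof -
      \<comment> \<open>Every \<open>x\<close> in \<open>W V\<close> satisfies the membership in
        \<open>r\<close> that the product \<open>p * r\<close> asks for, and \<open>W V\<close>
        belongs to \<open>p\<close>.\<close>
      have "W V \<in> usets p" using GW[OF V] p mem_F by blast
      then have "Lquot (G V) A \<in> usets e"
        unfolding p(2) mem_mult_iff by (rule usets_mono) (use quot_r V in blast)
      then show ?thesis using Lquot_mem_iff GW[OF V] by blast
    qed
    with e show ?c by blast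
  qed

  \<comment> \<open>Minimality and compactness: (c) implies (b)\<close>
  moreover have ?b if c: ?c
  proof -
    obtain e where e: "e \<in> idempotents (smallest_ideal T)"
      and eA: "\<And>V. V \<in> fsets F \<Longrightarrow> \<exists>x\<in>V. lquot x A \<in> usets e"
      using c by blast
    then obtain L where L: "minimal_left_ideal T L" "e \<in> L"
      by (auto simp: idempotents_def T.smallest_ideal_eq)
    have "syndetic F {x. lquot x A \<in> usets e}"
      unfolding syndetic_def
    proof
      fix V assume "V \<in> fsets F"
      then obtain V1 V2 where V: "V1 \<in> fsets F" "V2 \<in> fsets F" "V1 * V2 \<subseteq> V"
        using assms(3) by blast
      let ?B = "{x. lquot x A \<in> usets e}"
      \<comment> \<open>Quotients of \<open>?B\<close> in \<open>p\<close> become quotients of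
        \<open>A\<close> in \<open>p * e\<close>, which stays in \<open>L\<close>.\<close>
      have lquot_B: "lquot g ?B \<in> usets p \<longleftrightarrow> lquot g A \<in> usets (p * e)" for g p
        by (simp add: mem_mult_iff lquot_lquot) (simp add: lquot_def)
      have "\<exists>g\<in>V. lquot g ?B \<in> usets p" if "p \<in> T" for p
      proof -
        have "p * e \<in> L" using T.minimal_left_ideal_orbit[OF L] that by blast
        then obtain t where t: "t \<in> T" "e = t * (p * e)"
          using T.minimal_left_ideal_orbit[OF L(1)] L(2) by blast
        obtain x where x: "x \<in> V1" "lquot x A \<in> usets e" using eA V(1) by blast
        \<comment> \<open>Unfolding \<open>e = t * (p * e)\<close> yields \<open>t\<close>-many such
          \<open>y\<close>. Since \<open>V2\<close> belongs to \<open>t\<close>, one can be chosen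
          in \<open>V2\<close>, so that \<open>x * y\<close> lies in \<open>V\<close>.\<close>
        have "{y. lquot (x * y) A \<in> usets (p * e)} \<in> usets t"
          using x(2) mem_mult_iff[of "lquot x A" t "p * e"] t(2) by (simp add: lquot_lquot)
        moreover have "V2 \<in> usets t" using V(2) t(1) mem_F by blast
        ultimately have "{y. lquot (x * y) A \<in> usets (p * e)} \<inter> V2 \<noteq> {}"
          using usets_Int empty_notin_usets by metis
        then obtain y where "y \<in> V2" "lquot (x * y) A \<in> usets (p * e)" by blast
        moreover have "x * y \<in> V" using x(1) \<open>y \<in> V2\<close> V(3) by (blast intro: set_times_intro)
        ultimately show ?thesis using lquot_B by blast
      qed
      \<comment> \<open>The element \<open>g\<close> depends on \<open>p\<close>; a finite subcover
        gives one finite \<open>G\<close> that works for all of \<open>T\<close>, and hence for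
        \<open>F\<close>.\<close>
      then have "T \<subseteq> (\<Union>g\<in>V. basic_clopen (lquot g ?B))" by (auto simp: basic_clopen_def)
      then obtain G where G: "G \<subseteq> V" "finite G" "T \<subseteq> (\<Union>g\<in>G. basic_clopen (lquot g ?B))"
        by (rule compactE_image[OF T.compact open_basic_clopen])
      then have "Lquot G ?B \<in> fsets F"
        by (auto simp: mem_F Lquot_mem_iff basic_clopen_def)
      with G show "\<exists>G. finite G \<and> G \<subseteq> V \<and> Lquot G ?B \<in> fsets F" by blast
    qed
    with e show ?b by blast
  qed

  \<comment> \<open>The idempotent contains the required family: (b) implies (a)\<close>
  moreover have ?a if b: ?b
  proof -
    obtain e where e: "e \<in> idempotents (smallest_ideal T)"
      and syn: "syndetic F {x. lquot x A \<in> usets e}"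
      using b by blast
    then obtain L where "minimal_left_ideal T L" "e \<in> L"
      by (auto simp: idempotents_def T.smallest_ideal_eq)
    then have "e \<in> T" by (auto simp: minimal_left_ideal_def left_ideal_def)
    let ?B = "{x. lquot x A \<in> usets e}"
    obtain G where G: "\<And>V. V \<in> fsets F \<Longrightarrow> finite (G V) \<and> G V \<subseteq> V \<and> Lquot (G V) ?B \<in> fsets F"
      using bchoice[OF syn[unfolded syndetic_def]] by blast
    \<comment> \<open>The member of \<open>F\<close> supplied by syndeticity serves as
      \<open>W V\<close>: for \<open>x\<close> in it, some \<open>g\<close> in \<open>G V\<close>
      has \<open>g * x\<close> in \<open>?B\<close>.\<close>
    define W where "W V = Lquot (G V) ?B" for V
    have "lquot x (Lquot (G V) A) \<inter> V \<in> usets e" if "V \<in> fsets F" "x \<in> W V" for V x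
    proof -
      have "\<exists>g\<in>G V. lquot (g * x) A \<in> usets e"
        using that(2) by (auto simp: W_def Lquot_def lquot_def)
      then have "lquot x (Lquot (G V) A) \<in> usets e"
        using G that(1) by (simp add: Lquot_mult_mem_iff)
      then show ?thesis using that(1) \<open>e \<in> T\<close> mem_F by (simp add: usets_Int)
    qed
    then have "has_fip {lquot x (Lquot (G V) A) \<inter> V | V x. V \<in> fsets F \<and> x \<in> W V}"
      using G by (subst has_fip_iff_usets[OF family_ne]) (auto simp: W_def)
    then show ?a
      unfolding piecewise_syndetic_def
      by (intro exI[of _ G] exI[of _ W] conjI) (use G in \<open>auto simp: W_def\<close>)
  qed

  ultimately show ?thesis by blast
qed

end
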